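(* Let $Y(t)$, $t\in[0,\infty)$, be a solution in $\mathcal{M}_4$ of the rank-4 ODE \[ \dot Y=-P_Y R_\varepsilon(E)+\eta Y,\qquad \eta=\langle P_YR_\varepsilon(E),E\rangle,\qquad E=\Pi_{\mathcal{S}}Y, \] with initial value $Y(0)=Y_0\in\mathrm{Sym}(\mathbb{R}^{n\times n})\cap\mathcal{M}_4$. Assume that along the solution the eigenvalues $\lambda_k$ and $\lambda_{k+1}$ of $L(W+\varepsilon E(t))$ are simple. Then $Y(t)\in\mathrm{Sym}(\mathbb{R}^{n\times n})\cap\mathcal{M}_4$ for all $t$. Moreover, if $\|\Pi_{\mathcal{S}}Y_0\|_F=1$, then $\|\Pi_{\mathcal{S}}Y(t)\|_F=1$ for all $t$.
   Context: Let $\mathscr{E}\subseteq\{1,\dots,n\}^2$ be a symmetric edge set, and let $W\in\mathbb{R}^{n\times n}$ be symmetric, entrywise non-negative, with $w_{ij}=0$ for $(i,j)\notin\mathscr{E}$. Let $L(A)=\mathrm{diag}(A\mathbb{1})-A$ with $\mathbb{1}=(1,\dots,1)^T$. Eigenvalues are ordered $\lambda_1\le\dots\le\lambda_n$. The inner product is $\langle X,Y\rangle=\mathrm{trace}(X^TY)$ and $\|\cdot\|_F$ is the Frobenius norm. Let $\mathcal{S}=\{A: a_{ij}=0\ \forall (i,j)\notin\mathscr{E}\}$, and let $\Pi_{\mathcal{S}}$ be the orthogonal projection onto $\mathcal{S}$ (it zeroes the entries outside $\mathscr{E}$). Let $\mathcal{E}=\mathcal{S}\cap\mathrm{Sym}(\mathbb{R}^{n\times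 n})$. Fix $k\in\{2,\dots,n-1\}$ and $\varepsilon>0$. For $E\in\mathcal{E}$ with $\lambda_k,\lambda_{k+1}$ of $L(W+\varepsilon E)$ simple, let $x$ and $y$ be unit eigenvectors for $\lambda_{k+1}$ and $\lambda_k$ respectively. Set $z=x\bullet x-y\bullet y$ (componentwise product) and $R_\varepsilon(E)=\tfrac12(z\mathbb{1}^T+\mathbb{1}z^T)-xx^T+yy^T$. $\mathcal{M}_4$ is the manifold of real $n\times n$ matrices of rank exactly 4. $P_Y$ is the Frobenius-orthogonal projection onto the tangent space $T_Y\mathcal{M}_4$. For symmetric $Y=USU^T$, with $U\in\mathbb{R}^{n\times 4}$ having orthonormal columns and $S\in\mathrm{Sym}(\mathbb{R}^{4\times4})$ invertible, it is given by $P_YA=A-(I_n-UU^T)A(I_n-UU^T)$. *)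

theory Defs
  imports "HOL-Analysis.Analysis" "HOL-Computational_Algebra.Polynomial"
    "HOL-Library.Multiset"
begin

text \<open>Matrices are n x n real matrices, indexed by a finite type 'n with CARD('n) = n.
  The Frobenius inner product and norm are the library's inner and norm on real^'n^'n.\<close>

definition projS :: "('n \<times> 'n) set \<Rightarrow> real^'n^'n \<Rightarrow> real^'n^'n" where
  "projS Ed A = (\<chi> i j. if (i, j) \<in> Ed then A $ i $ j else 0)"

definition laplacian :: "real^'n^'n \<Rightarrow> real^'n^'n" where
  "laplacian A = (\<chi> i j. (if i = j then (\<Sum>l\<in>UNIV. A $ i $ l) else 0) - A $ i $ j)"

definition charpoly :: "real^'n^'n \<Rightarrow> real poly" where
  "charpoly A = det (\<chi> i j. (if i = j then [:0, 1:] else 0) - [:A $ i $ j:])"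

text \<open>Real eigenvalues counted with algebraic multiplicity, sorted increasingly;
  entry number (k-1) of this list is lambda_k.\<close>
definition eigenvalues :: "real^'n^'n \<Rightarrow> real list" where
  "eigenvalues A = sorted_list_of_multiset (proots (charpoly A))"

definition eig :: "real^'n^'n \<Rightarrow> nat \<Rightarrow> real" where
  "eig A k = eigenvalues A ! (k - 1)"

text \<open>lambda_k is a well-defined (all n eigenvalues real) and simple eigenvalue.\<close>
definition eig_simple :: "real^'n^'n \<Rightarrow> nat \<Rightarrow> bool" where
  "eig_simple A k \<longleftrightarrow> length (eigenvalues A) = CARD('n) \<and> 1 \<le> k \<and> k \<le> CARD('n)
     \<and> order (eig A k) (charpoly A) = 1"

definition unit_eigvec :: "real^'n^'n \<Rightarrow> real \<Rightarrow> real^'n" where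
  "unit_eigvec A lam = (SOME x. norm x = 1 \<and> A *v x = lam *\<^sub>R x)"

definition Rmat :: "real^'n^'n \<Rightarrow> nat \<Rightarrow> real \<Rightarrow> real^'n^'n \<Rightarrow> real^'n^'n" where
  "Rmat W k \<epsilon> E =
    (let M = laplacian (W + \<epsilon> *\<^sub>R E);
         x = unit_eigvec M (eig M (k + 1));
         y = unit_eigvec M (eig M k);
         z = (\<chi> i. x $ i * x $ i - y $ i * y $ i)
     in (\<chi> i j. (z $ i + z $ j) / 2 - x $ i * x $ j + y $ i * y $ j))"

text \<open>Orthogonal projector onto the column space of Y.\<close>
definition colproj :: "real^'n^'n \<Rightarrow> real^'n^'n" where
  "colproj Y = (THE P. transpose P = P \<and> P ** P = P \<and> range ((*v) P) = range ((*v) Y))"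

text \<open>Orthogonal projection onto the tangent space of the fixed-rank manifold at Y:
  P_Y A = A - (I - U U^T) A (I - V V^T), U, V orthonormal bases of column and row space.\<close>
definition tangent_proj :: "real^'n^'n \<Rightarrow> real^'n^'n \<Rightarrow> real^'n^'n" where
  "tangent_proj Y A = A - (mat 1 - colproj Y) ** A ** (mat 1 - colproj (transpose Y))"

end

theory Submission
  imports Defs
begin

(* Write A = Y - Y^T.  Since R_eps(E) is symmetric, the skew part of P_Y R involves only the
   difference between the orthogonal projectors onto the column and the row space of Y, and near a
   symmetric matrix of the same rank this difference is O(|A|), because preimages under matrices of
   fixed rank depend boundedly on the matrix.  Hence |A'| <= C |A| right after every time where A
   vanishes, and a Gronwall argument from the last zero of |A|^2 shows A = 0 throughout.
   Likewise, Pi_S being an orthogonal projection and eta = <P_Y R, E>, the function f = |E|^2 - 1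
   satisfies f' = 2 eta f, so it stays 0 by the same argument.
   Only symmetry and boundedness of R_eps(E) are used; boundedness needs unit eigenvectors, which
   exist by the simplicity hypothesis. *)

(* Keep transpose A *v x as it is instead of rewriting it to x v* A. *)
declare transpose_matrix_vector[simp del] vector_transpose_matrix[simp del]

lemma transpose_diff: "transpose (A - B) = transpose A - transpose (B::'a::ab_group_add^'n^'m)"
  by (simp add: transpose_def vec_eq_iff)

lemma inner_transpose_matrix_vector:
  fixes A :: "real^'n^'m"
  shows "inner (transpose A *v y) x = inner y (A *v x)"
  by (simp add: transpose_matrix_vector dot_lmul_matrix)

lemma norm_matrix_vector_mult_le:
  fixes M :: "real^'n^'m"
  shows "norm (M *v x) \<le> norm M * norm x"
proof -
  have "(norm (M *v x))\<^sup>2 = (\<Sum>i\<in>UNIV. (inner (M $ i) x)\<^sup>2)"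
    unfolding power2_norm_eq_inner by (simp add: inner_vec_def matrix_vector_mult_def power2_eq_square)
  also have "\<dots> \<le> (\<Sum>i\<in>UNIV. inner (M $ i) (M $ i) * inner x x)"
    by (intro sum_mono Cauchy_Schwarz_ineq)
  also have "\<dots> = (norm M * norm x)\<^sup>2"
    by (simp add: power_mult_distrib power2_norm_eq_inner inner_vec_def[of M M] sum_distrib_right)
  finally show ?thesis
    by (rule power2_le_imp_le) simp
qed

lemma power2_norm_matrix:
  fixes M :: "real^'n^'m"
  shows "(norm M)\<^sup>2 = (\<Sum>i\<in>UNIV. \<Sum>j\<in>UNIV. (M $ i $ j)\<^sup>2)"
  unfolding power2_norm_eq_inner by (simp add: inner_vec_def power2_eq_square)

lemma norm_transpose_matrix:
  fixes M :: "real^'n^'m"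
  shows "norm (transpose M) = norm M"
proof -
  have "(norm (transpose M))\<^sup>2 = (norm M)\<^sup>2"
    unfolding power2_norm_matrix by (subst sum.swap) (simp add: transpose_def)
  then show ?thesis
    by (simp add: power2_eq_iff_nonneg)
qed

lemma norm_matrix_le_columns:
  fixes M :: "real^'n^'m"
  shows "norm M \<le> (\<Sum>j\<in>UNIV. norm (M *v axis j 1))"
proof -
  have "norm M = norm (transpose M)"
    by (simp add: norm_transpose_matrix)
  also have "\<dots> \<le> (\<Sum>j\<in>UNIV. norm (transpose M $ j))"
    unfolding norm_vec_def by (rule L2_set_le_sum) auto
  also have "\<dots> = (\<Sum>j\<in>UNIV. norm (M *v axis j 1))"
    by (simp add: matrix_vector_mult_basis column_def transpose_def)
  finally show ?thesis .
qed

lemma norm_matrix_le_of_vector_bound: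
  fixes M :: "real^'n^'m"
  assumes "\<And>x. norm (M *v x) \<le> c * norm x"
  shows "norm M \<le> real CARD('n) * c"
proof -
  have "norm M \<le> (\<Sum>j\<in>UNIV. norm (M *v axis j 1))"
    by (rule norm_matrix_le_columns)
  also have "\<dots> \<le> (\<Sum>j\<in>(UNIV::'n set). c)"
    by (rule sum_mono) (use assms[of "axis _ 1"] in simp)
  finally show ?thesis by simp
qed

lemma nonneg_of_matrix_vector_bound:
  fixes M :: "real^'n^'m"
  assumes "\<And>x. norm (M *v x) \<le> c * norm x"
  shows "c \<ge> 0"
  using order_trans[OF norm_ge_zero assms[of "axis undefined 1"]] by simp

lemma transpose_matrix_vector_bound:
  fixes M :: "real^'n^'m"
  assumes bound: "\<And>x. norm (M *v x) \<le> c * norm x"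
  shows "norm (transpose M *v y) \<le> c * norm y"
proof -
  let ?z = "transpose M *v y"
  have "norm ?z * norm ?z = inner ?z ?z"
    by (metis power2_eq_square power2_norm_eq_inner)
  also have "\<dots> = inner y (M *v ?z)"
    by (rule inner_transpose_matrix_vector)
  also have "\<dots> \<le> norm y * (c * norm ?z)"
    using norm_cauchy_schwarz[of y "M *v ?z"] bound[of ?z] by (meson mult_left_mono norm_ge_zero order_trans)
  finally have "norm ?z * norm ?z \<le> (c * norm y) * norm ?z"
    by (simp add: algebra_simps)
  then show ?thesis
    using nonneg_of_matrix_vector_bound[OF bound] by (cases "norm ?z = 0") (auto simp: mult_le_cancel_right)
qed

lemma norm_matrix_le_sum_abs_entries:
  fixes M :: "real^'n^'m"
  shows "norm M \<le> (\<Sum>i\<in>UNIV. \<Sum>j\<in>UNIV. \<bar>M $ i $ j\<bar>)"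
proof -
  have "norm M \<le> (\<Sum>i\<in>UNIV. norm (M $ i))"
    unfolding norm_vec_def by (rule L2_set_le_sum) auto
  also have "\<dots> \<le> (\<Sum>i\<in>UNIV. \<Sum>j\<in>UNIV. \<bar>M $ i $ j\<bar>)"
    by (intro sum_mono norm_le_l1_cart)
  finally show ?thesis .
qed

lemma subspace_range_matrix_vector_mult:
  fixes P :: "real^'n^'m"
  shows "subspace (range ((*v) P))"
  by (rule linear_subspace_image[OF matrix_vector_mul_linear subspace_UNIV])

lemma outer_product_sum_matrix_vector_mult:
  fixes B :: "(real^'n) set"
  shows "(\<chi> i j. \<Sum>b\<in>B. b $ i * b $ j) *v x = (\<Sum>b\<in>B. inner b x *\<^sub>R b)"
proof -
  have "((\<chi> i j. \<Sum>b\<in>B. b $ i * b $ j) *v x) $ i = (\<Sum>b\<in>B. inner b x *\<^sub>R b) $ i" for i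
  proof -
    have "((\<chi> i j. \<Sum>b\<in>B. b $ i * b $ j) *v x) $ i = (\<Sum>j\<in>UNIV. \<Sum>b\<in>B. b $ i * b $ j * x $ j)"
      unfolding matrix_vector_mult_def by (simp add: sum_distrib_right)
    also have "\<dots> = (\<Sum>b\<in>B. \<Sum>j\<in>UNIV. b $ i * b $ j * x $ j)"
      by (rule sum.swap)
    also have "\<dots> = (\<Sum>b\<in>B. inner b x * b $ i)"
      by (simp add: inner_vec_def sum_distrib_left sum_distrib_right mult.commute mult.left_commute)
    finally show ?thesis
      by (simp add: sum_component)
  qed
  then show ?thesis
    by (simp add: vec_eq_iff)
qed

lemma orthogonal_projection_matrix_exists:
  fixes S :: "(real^'n) set"
  assumes "subspace S"
  shows "\<exists>P::real^'n^'n. transpose P = P \<and> P ** P = P \<and> range ((*v) P) = S"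
proof -
  obtain B where B: "B \<subseteq> S" "pairwise orthogonal B" "\<And>x. x \<in> B \<Longrightarrow> norm x = 1"
    "independent B" "card B = dim S" "span B = S"
    using orthonormal_basis_subspace[OF assms] by blast
  have "finite B"
    using B(4) independent_imp_finite by blast
  define P :: "real^'n^'n" where "P = (\<chi> i j. \<Sum>b\<in>B. b $ i * b $ j)"
  have P_apply: "P *v x = (\<Sum>b\<in>B. inner b x *\<^sub>R b)" for x
    unfolding P_def by (rule outer_product_sum_matrix_vector_mult)
  have P_basis: "P *v b = b" if "b \<in> B" for b
  proof -
    have "P *v b = inner b b *\<^sub>R b + (\<Sum>c\<in>B-{b}. inner c b *\<^sub>R c)"
      using P_apply \<open>finite B\<close> that by (simp add: sum.remove)
    also have "(\<Sum>c\<in>B-{b}. inner c b *\<^sub>R c) = 0"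
      using B(2) that by (intro sum.neutral) (auto simp: pairwise_def orthogonal_def)
    also have "inner b b = 1"
      using B(3)[OF that] by (simp add: norm_eq_sqrt_inner)
    finally show ?thesis by simp
  qed
  have fixes_S: "P *v x = x" if "x \<in> S" for x
  proof -
    have "subspace {x. P *v x = x}"
      unfolding subspace_def by (auto simp: algebra_simps)
    then have "span B \<subseteq> {x. P *v x = x}"
      using P_basis by (intro span_minimal) auto
    then show ?thesis
      using that B(6) by auto
  qed
  have into_S: "P *v x \<in> S" for x
    unfolding P_apply using B(1) assms by (intro subspace_sum subspace_scale) auto
  have "transpose P = P"
    unfolding P_def transpose_def by (simp add: mult.commute)
  moreover have "P ** P = P"
    by (simp add: matrix_eq matrix_vector_mul_assoc[symmetric] fixes_S into_S)
  moreover have "range ((*v) P) = S"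
  proof
    show "range ((*v) P) \<subseteq> S"
      using into_S by auto
    show "S \<subseteq> range ((*v) P)"
      using fixes_S by (metis rangeI subsetI)
  qed
  ultimately show ?thesis by blast
qed

lemma idempotent_mult_eq_of_range_subset:
  fixes P Q :: "real^'n^'n"
  assumes "Q ** Q = Q" "range ((*v) P) \<subseteq> range ((*v) Q)"
  shows "Q ** P = P"
  unfolding matrix_eq
proof
  fix x
  obtain z where z: "P *v x = Q *v z"
    using assms(2) by blast
  have "Q *v (P *v x) = P *v x"
    unfolding z matrix_vector_mul_assoc assms(1) ..
  then show "(Q ** P) *v x = P *v x"
    by (simp add: matrix_vector_mul_assoc)
qed

lemma orthogonal_projection_matrix_unique:
  fixes P Q :: "real^'n^'n"
  assumes "transpose P = P" "P ** P = P" "transpose Q = Q" "Q ** Q = Q"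
    and "range ((*v) P) = range ((*v) Q)"
  shows "P = Q"
proof -
  have QP: "Q ** P = P" and PQ: "P ** Q = Q"
    using assms by (auto intro: idempotent_mult_eq_of_range_subset)
  have "P = transpose (Q ** P)"
    using QP assms(1) by simp
  also have "\<dots> = P ** Q"
    by (simp add: matrix_transpose_mul assms(1,3))
  finally show ?thesis
    using PQ by simp
qed

lemma orthogonal_projection_colproj:
  fixes Y :: "real^'n^'n"
  shows "transpose (colproj Y) = colproj Y \<and> colproj Y ** colproj Y = colproj Y
     \<and> range ((*v) (colproj Y)) = range ((*v) Y)"
proof -
  obtain P :: "real^'n^'n"
    where P: "transpose P = P \<and> P ** P = P \<and> range ((*v) P) = range ((*v) Y)"
    using orthogonal_projection_matrix_exists[OF subspace_range_matrix_vector_mult] by blast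
  show ?thesis
    unfolding colproj_def
  proof (rule theI[of _ P])
    fix Q assume "transpose Q = Q \<and> Q ** Q = Q \<and> range ((*v) Q) = range ((*v) Y)"
    then show "Q = P"
      using P by - (rule orthogonal_projection_matrix_unique, simp_all)
  qed (rule P)
qed

lemmas transpose_colproj = orthogonal_projection_colproj[THEN conjunct1]
  and colproj_idem = orthogonal_projection_colproj[THEN conjunct2, THEN conjunct1]
  and range_colproj = orthogonal_projection_colproj[THEN conjunct2, THEN conjunct2]

lemma colproj_mult_self: "colproj Y ** Y = Y"
  for Y :: "real^'n^'n"
  by (rule idempotent_mult_eq_of_range_subset[OF colproj_idem]) (simp add: range_colproj)

lemma orthogonal_projection_norm_le:
  fixes P :: "real^'n^'n"
  assumes "transpose P = P" "P ** P = P"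
  shows "norm (P *v x) \<le> norm x"
proof -
  have "norm (P *v x) * norm (P *v x) = inner (P *v x) (P *v x)"
    by (metis power2_eq_square power2_norm_eq_inner)
  also have "\<dots> = inner x (P *v (P *v x))"
    using inner_transpose_matrix_vector[of P "P *v x" x, unfolded assms(1)] by (simp add: inner_commute)
  also have "\<dots> = inner x (P *v x)"
    by (simp add: matrix_vector_mul_assoc assms(2))
  also have "\<dots> \<le> norm x * norm (P *v x)"
    by (rule norm_cauchy_schwarz)
  finally show ?thesis
    by (cases "norm (P *v x) = 0") (auto simp: mult_le_cancel_right)
qed

lemma orthogonal_projection_complement:
  fixes P :: "real^'n^'n"
  assumes "transpose P = P" "P ** P = P"
  shows "transpose (mat 1 - P) = mat 1 - P" "(mat 1 - P) ** (mat 1 - P) = mat 1 - P"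
proof -
  show "transpose (mat 1 - P) = mat 1 - P"
    using assms(1) by (simp add: transpose_diff)
  have "P *v (P *v x) = P *v x" for x
    using assms(2) by (simp add: matrix_vector_mul_assoc)
  then have "(mat 1 - P) *v ((mat 1 - P) *v x) = (mat 1 - P) *v x" for x
    by (simp add: algebra_simps)
  then show "(mat 1 - P) ** (mat 1 - P) = mat 1 - P"
    by (simp add: matrix_eq matrix_vector_mul_assoc)
qed

lemma norm_colproj_le: "norm (colproj Y *v x) \<le> norm x"
  for Y :: "real^'n^'n"
  by (rule orthogonal_projection_norm_le) (use orthogonal_projection_colproj in auto)

lemma norm_colproj_complement_le: "norm ((mat 1 - colproj Y) *v x) \<le> norm x"
  for Y :: "real^'n^'n"
  by (rule orthogonal_projection_norm_le; rule orthogonal_projection_complement) (use orthogonal_projection_colproj in auto)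

lemma transpose_colproj_complement: "transpose (mat 1 - colproj Y) = mat 1 - colproj Y"
  for Y :: "real^'n^'n"
  by (rule orthogonal_projection_complement) (use orthogonal_projection_colproj in auto)

definition bounded_preimages :: "real^'n^'m \<Rightarrow> real \<Rightarrow> bool" where
  "bounded_preimages Z C \<longleftrightarrow> (\<forall>v\<in>range ((*v) Z). \<exists>u. Z *v u = v \<and> norm u \<le> C * norm v)"

lemma row_space_lower_bound:
  fixes Z :: "real^'n^'m"
  obtains e where "e > 0" "\<And>x. x \<in> range ((*v) (transpose Z)) \<Longrightarrow> e * norm x \<le> norm (Z *v x)"
proof -
  let ?B = "range ((*v) (transpose Z))"
  have "subspace ?B"
    by (rule subspace_range_matrix_vector_mult)
  have "\<forall>x\<in>?B. Z *v x = 0 \<longrightarrow> x = 0"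
  proof (intro ballI impI)
    fix x assume "x \<in> ?B" "Z *v x = 0"
    then obtain y where "x = transpose Z *v y"
      by blast
    then have "inner x x = inner y (Z *v x)"
      by (simp add: inner_transpose_matrix_vector)
    then show "x = 0"
      using \<open>Z *v x = 0\<close> by simp
  qed
  then show ?thesis
    using injective_imp_isometric[OF closed_subspace[OF \<open>subspace ?B\<close>] \<open>subspace ?B\<close>
        matrix_vector_mul_bounded_linear] that
    by blast
qed

lemma image_eq_range_if_inj_on:
  fixes Z :: "real^'n^'m"
  assumes "subspace B" "inj_on ((*v) Z) B" "dim B = rank Z"
  shows "(*v) Z ` B = range ((*v) Z)"
proof (rule subspace_dim_equal)
  have "span B = B"
    using \<open>subspace B\<close> by (simp add: span_eq_iff)
  with assms(2) have "inj_on ((*v) Z) (span B)"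
    by (simp only:)
  then have "dim ((*v) Z ` B) = dim B"
    by (rule dim_image_eq[OF matrix_vector_mul_linear])
  then show "dim ((*v) Z ` B) \<ge> dim (range ((*v) Z))"
    using assms(3) by (simp add: rank_dim_range)
qed (use assms(1) subspace_range_matrix_vector_mult linear_subspace_image[OF matrix_vector_mul_linear] in auto)

text \<open>A matrix close to \<open>Z0\<close> is still bounded below on the row space of \<open>Z0\<close>; having the same
  rank, it maps that space onto its whole range.\<close>

lemma bounded_preimages_near_same_rank:
  fixes Z0 :: "real^'n^'m"
  obtains \<delta> C where "\<delta> > 0" "C \<ge> 0"
    "\<And>Z. rank Z = rank Z0 \<Longrightarrow> norm (Z - Z0) < \<delta> \<Longrightarrow> bounded_preimages Z C"
proof -
  define B where "B = range ((*v) (transpose Z0))"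
  obtain e where e: "e > 0" "\<And>x. x \<in> B \<Longrightarrow> e * norm x \<le> norm (Z0 *v x)"
    using row_space_lower_bound[of Z0] unfolding B_def by blast
  show ?thesis
  proof
    show "e / 2 > 0" "2 / e \<ge> 0"
      using e by auto
    fix Z :: "real^'n^'m"
    assume rank: "rank Z = rank Z0" and near: "norm (Z - Z0) < e / 2"
    have lower: "e / 2 * norm x \<le> norm (Z *v x)" if "x \<in> B" for x
    proof -
      have "norm ((Z - Z0) *v x) \<le> e / 2 * norm x"
        using norm_matrix_vector_mult_le[of "Z - Z0" x] near
        by (meson less_imp_le mult_right_mono norm_ge_zero order_trans)
      moreover have "norm (Z0 *v x) \<le> norm (Z *v x) + norm ((Z - Z0) *v x)"
        using norm_triangle_ineq4[of "Z *v x" "(Z - Z0) *v x"] by (simp add: algebra_simps)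
      ultimately show ?thesis
        using e(2)[OF that] by linarith
    qed
    have "subspace B"
      unfolding B_def by (rule subspace_range_matrix_vector_mult)
    moreover have "inj_on ((*v) Z) B"
    proof (rule inj_onI)
      fix x y assume "x \<in> B" "y \<in> B" "Z *v x = Z *v y"
      then have "e / 2 * norm (x - y) \<le> 0"
        using lower[of "x - y"] \<open>subspace B\<close> by (simp add: subspace_diff algebra_simps)
      then show "x = y"
        using e by (simp add: mult_le_0_iff)
    qed
    moreover have "dim B = rank Z"
      using rank by (simp add: B_def rank_transpose flip: rank_dim_range)
    ultimately have image_B: "(*v) Z ` B = range ((*v) Z)"
      by (rule image_eq_range_if_inj_on)
    show "bounded_preimages Z (2 / e)"
      unfolding bounded_preimages_def
    proof
      fix v assume "v \<in> range ((*v) Z)"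
      then obtain x where "x \<in> B" "v = Z *v x"
        unfolding image_B[symmetric] by blast
      moreover have "norm x \<le> 2 / e * norm (Z *v x)"
        using lower[OF \<open>x \<in> B\<close>] e by (simp add: field_simps)
      ultimately show "\<exists>u. Z *v u = v \<and> norm u \<le> 2 / e * norm v"
        by blast
    qed
  qed
qed

lemma colproj_complement_colproj_transpose_bound:
  fixes Y :: "real^'n^'n"
  assumes preimages: "bounded_preimages (transpose Y) C" and "C \<ge> 0"
  shows "norm ((mat 1 - colproj Y) *v (colproj (transpose Y) *v x))
           \<le> C * norm (Y - transpose Y) * norm x"
proof -
  define v where "v = colproj (transpose Y) *v x"
  have "v \<in> range ((*v) (transpose Y))"
    unfolding v_def using range_colproj by blast
  then obtain u where u: "transpose Y *v u = v" "norm u \<le> C * norm v"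
    using preimages unfolding bounded_preimages_def by blast
  have "colproj Y *v (Y *v u) = Y *v u"
    by (simp add: matrix_vector_mul_assoc colproj_mult_self)
  then have "(mat 1 - colproj Y) *v (Y *v u) = 0"
    by (simp add: matrix_vector_mult_diff_rdistrib)
  then have "(mat 1 - colproj Y) *v v = (mat 1 - colproj Y) *v ((transpose Y - Y) *v u)"
    unfolding u(1)[symmetric] by (simp add: algebra_simps)
  then have "norm ((mat 1 - colproj Y) *v v) \<le> norm ((transpose Y - Y) *v u)"
    by (metis norm_colproj_complement_le)
  also have "\<dots> \<le> norm (Y - transpose Y) * norm u"
    using norm_matrix_vector_mult_le[of "transpose Y - Y" u] by (simp add: norm_minus_commute)
  also have "\<dots> \<le> norm (Y - transpose Y) * (C * norm x)"
    using u(2) norm_colproj_le[of "transpose Y" x] \<open>C \<ge> 0\<close>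
    unfolding v_def by (meson mult_left_mono norm_ge_zero order_trans)
  finally show ?thesis
    unfolding v_def by (simp add: mult_ac)
qed

lemma colproj_transpose_diff_bound:
  fixes Y :: "real^'n^'n"
  assumes "bounded_preimages Y C" "bounded_preimages (transpose Y) C" "C \<ge> 0"
  shows "norm ((colproj Y - colproj (transpose Y)) *v x) \<le> 2 * C * norm (Y - transpose Y) * norm x"
proof -
  let ?P = "colproj Y" and ?Q = "colproj (transpose Y)" and ?c = "C * norm (Y - transpose Y)"
  have "norm ((mat 1 - ?Q) *v (?P *v w)) \<le> ?c * norm w" for w
    using colproj_complement_colproj_transpose_bound[of "transpose Y" C w] assms
    by (simp add: norm_minus_commute)
  then have "norm (transpose ((mat 1 - ?Q) ** ?P) *v w) \<le> ?c * norm w" for w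
    by (intro transpose_matrix_vector_bound) (simp add: matrix_vector_mul_assoc[symmetric])
  then have PQ: "norm (?P *v ((mat 1 - ?Q) *v w)) \<le> ?c * norm w" for w
    by (simp add: matrix_transpose_mul transpose_colproj transpose_colproj_complement
        matrix_vector_mul_assoc)
  have QP: "norm ((mat 1 - ?P) *v (?Q *v w)) \<le> ?c * norm w" for w
    using colproj_complement_colproj_transpose_bound[of Y C w] assms by simp
  have "(?P - ?Q) *v x = ?P *v ((mat 1 - ?Q) *v x) - (mat 1 - ?P) *v (?Q *v x)"
    by (simp add: algebra_simps)
  then have "norm ((?P - ?Q) *v x) \<le> norm (?P *v ((mat 1 - ?Q) *v x)) + norm ((mat 1 - ?P) *v (?Q *v x))"
    by (metis norm_triangle_ineq4)
  also have "\<dots> \<le> 2 * ?c * norm x"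
    using PQ[of x] QP[of x] by simp
  finally show ?thesis
    by (simp add: mult_ac)
qed

lemma tangent_proj_apply:
  fixes Y R :: "real^'n^'n"
  shows "tangent_proj Y R *v x
           = R *v x - (mat 1 - colproj Y) *v (R *v ((mat 1 - colproj (transpose Y)) *v x))"
  unfolding tangent_proj_def
  by (simp add: matrix_vector_mult_diff_rdistrib matrix_vector_mul_assoc[symmetric])

lemma norm_tangent_proj_le:
  fixes Y R :: "real^'n^'n"
  shows "norm (tangent_proj Y R) \<le> 2 * real CARD('n) * norm R"
proof -
  have "norm (tangent_proj Y R *v x) \<le> 2 * norm R * norm x" for x
  proof -
    have "norm ((mat 1 - colproj Y) *v (R *v ((mat 1 - colproj (transpose Y)) *v x)))
        \<le> norm R * norm x"
      by (meson norm_colproj_complement_le norm_matrix_vector_mult_le mult_left_mono norm_ge_zero order_trans)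
    moreover have "norm (tangent_proj Y R *v x)
        \<le> norm (R *v x) + norm ((mat 1 - colproj Y) *v (R *v ((mat 1 - colproj (transpose Y)) *v x)))"
      unfolding tangent_proj_apply by (rule norm_triangle_ineq4)
    ultimately show ?thesis
      using norm_matrix_vector_mult_le[of R x] by simp
  qed
  then have "norm (tangent_proj Y R) \<le> real CARD('n) * (2 * norm R)"
    by (rule norm_matrix_le_of_vector_bound)
  then show ?thesis
    by (simp add: mult_ac)
qed

lemma tangent_proj_skew_apply:
  fixes Y R :: "real^'n^'n"
  assumes "transpose R = R"
  shows "(tangent_proj Y R - transpose (tangent_proj Y R)) *v x =
     (colproj Y - colproj (transpose Y)) *v (R *v ((mat 1 - colproj Y) *v x))
     - (mat 1 - colproj Y) *v (R *v ((colproj Y - colproj (transpose Y)) *v x))"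
proof -
  have transpose_tangent_proj: "transpose (tangent_proj Y R)
          = R - (mat 1 - colproj (transpose Y)) ** R ** (mat 1 - colproj Y)"
    unfolding tangent_proj_def transpose_diff matrix_transpose_mul assms
    by (simp add: matrix_mul_assoc transpose_colproj)
  show ?thesis
    unfolding transpose_tangent_proj unfolding tangent_proj_def
    by (simp add: matrix_vector_mult_diff_rdistrib matrix_vector_mul_assoc[symmetric] algebra_simps)
qed

lemma norm_tangent_proj_skew_le:
  fixes Y R :: "real^'n^'n"
  assumes "transpose R = R"
    and diff_bound: "\<And>x. norm ((colproj Y - colproj (transpose Y)) *v x) \<le> d * norm x"
  shows "norm (tangent_proj Y R - transpose (tangent_proj Y R)) \<le> 2 * real CARD('n) * d * norm R"
proof -
  let ?P = "colproj Y" and ?Q = "colproj (transpose Y)"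
  have "d \<ge> 0"
    using diff_bound by (rule nonneg_of_matrix_vector_bound)
  have "norm ((tangent_proj Y R - transpose (tangent_proj Y R)) *v x) \<le> 2 * d * norm R * norm x" for x
  proof -
    have "norm ((?P - ?Q) *v (R *v ((mat 1 - ?P) *v x))) \<le> d * (norm R * norm x)"
      using diff_bound norm_matrix_vector_mult_le norm_colproj_complement_le \<open>d \<ge> 0\<close>
      by (meson mult_left_mono norm_ge_zero order_trans)
    moreover have "norm ((mat 1 - ?P) *v (R *v ((?P - ?Q) *v x))) \<le> norm R * (d * norm x)"
      using diff_bound norm_matrix_vector_mult_le norm_colproj_complement_le
      by (meson mult_left_mono norm_ge_zero order_trans)
    moreover have "norm ((tangent_proj Y R - transpose (tangent_proj Y R)) *v x)
        \<le> norm ((?P - ?Q) *v (R *v ((mat 1 - ?P) *v x)))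
          + norm ((mat 1 - ?P) *v (R *v ((?P - ?Q) *v x)))"
      unfolding tangent_proj_skew_apply[OF assms(1)] by (rule norm_triangle_ineq4)
    ultimately show ?thesis
      by (simp add: algebra_simps)
  qed
  then have "norm (tangent_proj Y R - transpose (tangent_proj Y R)) \<le> real CARD('n) * (2 * d * norm R)"
    by (rule norm_matrix_le_of_vector_bound)
  then show ?thesis
    by (simp add: mult_ac)
qed

lemma gronwall_interval_zero:
  fixes g g' :: "real \<Rightarrow> real"
  assumes "s < t" "continuous_on {s..t} g" "g s = 0" "g t \<ge> 0"
    and deriv: "\<And>u. s < u \<Longrightarrow> u < t \<Longrightarrow> (g has_real_derivative g' u) (at u)"
    and gronwall: "\<And>u. s < u \<Longrightarrow> u < t \<Longrightarrow> g' u \<le> C * g u"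
  shows "g t = 0"
proof -
  define h where "h u = g u * exp (- C * u)" for u
  have "h t \<le> h s"
  proof (rule DERIV_nonpos_imp_decreasing_open[OF less_imp_le[OF \<open>s < t\<close>]])
    fix u assume u: "s < u" "u < t"
    then have "(h has_real_derivative (g' u - C * g u) * exp (- C * u)) (at u)"
      unfolding h_def using deriv by (auto intro!: derivative_eq_intros simp: algebra_simps)
    moreover have "(g' u - C * g u) * exp (- C * u) \<le> 0"
      using gronwall[OF u] by (simp add: mult_nonpos_nonneg)
    ultimately show "\<exists>y. (h has_real_derivative y) (at u) \<and> y \<le> 0"
      by blast
  next
    show "continuous_on {s..t} h"
      unfolding h_def using assms(2) by (intro continuous_intros)
  qed
  then show ?thesis
    using assms(3,4) unfolding h_def by (simp add: mult_le_0_iff)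
qed

lemma nonneg_stays_zero_if_locally_gronwall:
  fixes g g' :: "real \<Rightarrow> real"
  assumes deriv: "\<And>t. t \<ge> 0 \<Longrightarrow> (g has_real_derivative g' t) (at t within {0..})"
    and nonneg: "\<And>t. t \<ge> 0 \<Longrightarrow> g t \<ge> 0" and "g 0 = 0"
    and gronwall: "\<And>t. t \<ge> 0 \<Longrightarrow> g t = 0 \<Longrightarrow> \<exists>C. \<forall>\<^sub>F u in at_right t. g' u \<le> C * g u"
    and "t1 \<ge> 0"
  shows "g t1 = 0"
proof (rule ccontr)
  assume "g t1 \<noteq> 0"
  have cont: "continuous_on {0..} g"
    using deriv by (intro DERIV_continuous_on) auto
  define S where "S = {0..t1} \<inter> g -` {0}"
  have "closed S"
    unfolding S_def by (intro continuous_closed_preimage continuous_on_subset[OF cont]) auto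
  moreover have "0 \<in> S" "bdd_above S"
    unfolding S_def using \<open>t1 \<ge> 0\<close> \<open>g 0 = 0\<close> by (auto intro: bdd_aboveI[of _ t1])
  ultimately have "Sup S \<in> S"
    using closed_contains_Sup by blast
  define s where "s = Sup S"
  have s: "0 \<le> s" "s < t1" "g s = 0"
    using \<open>Sup S \<in> S\<close> \<open>g t1 \<noteq> 0\<close> unfolding s_def S_def by (auto simp: order_le_less)
  obtain C b where "b > s" and C: "\<And>u. s < u \<Longrightarrow> u < b \<Longrightarrow> g' u \<le> C * g u"
    using gronwall[OF s(1,3)] unfolding eventually_at_right_field by blast
  define t2 where "t2 = min t1 ((s + b) / 2)"
  have t2: "s < t2" "t2 \<le> t1" "t2 < b"
    unfolding t2_def using \<open>s < t1\<close> \<open>b > s\<close> by (auto simp: min_less_iff_disj)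
  have "g t2 = 0"
  proof (rule gronwall_interval_zero[where g = g and g' = g' and C = C, OF \<open>s < t2\<close> _ \<open>g s = 0\<close>])
    show "continuous_on {s..t2} g"
      using s(1) by (intro continuous_on_subset[OF cont]) auto
    show "g t2 \<ge> 0"
      using nonneg s(1) t2(1) by simp
    show "(g has_real_derivative g' u) (at u)" if "s < u" "u < t2" for u
      using deriv[of u] that s(1) at_within_interior[of u "{0..}"] by simp
    show "g' u \<le> C * g u" if "s < u" "u < t2" for u
      using C that t2 by simp
  qed
  then have "t2 \<le> s"
    unfolding s_def S_def using s t2 \<open>bdd_above S\<close> by (intro cSup_upper) (auto simp: S_def)
  then show False
    using t2 by simp
qed

lemma eventually_at_right_near:
  fixes Y :: "real \<Rightarrow> 'a::real_normed_vector"
  assumes "continuous (at t0 within {0..}) Y" "t0 \<ge> 0" "e > 0"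
  shows "\<forall>\<^sub>F t in at_right t0. norm (Y t - Y t0) < e"
proof -
  have "\<forall>\<^sub>F t in at t0 within {0..}. dist (Y t) (Y t0) < e"
    using assms(1,3) unfolding continuous_within by (rule tendstoD)
  moreover have "at_right t0 \<le> at t0 within {0..}"
    using assms(2) by (intro at_le) auto
  ultimately show ?thesis
    by (auto simp: dist_norm elim: filter_leD)
qed

lemma projS_idem: "projS Ed (projS Ed X) = projS Ed X"
  by (simp add: projS_def vec_eq_iff)

lemma inner_projS: "inner (projS Ed X) Z = inner X (projS Ed Z)"
  unfolding inner_vec_def projS_def by (intro sum.cong refl) auto

lemma norm_projS_le: "norm (projS Ed X) \<le> norm X"
proof -
  have "norm (projS Ed X) * norm (projS Ed X) = inner X (projS Ed X)"
    by (metis inner_projS projS_idem power2_eq_square power2_norm_eq_inner)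
  also have "\<dots> \<le> norm X * norm (projS Ed X)"
    by (rule norm_cauchy_schwarz)
  finally show ?thesis
    by (cases "norm (projS Ed X) = 0") (auto simp: mult_le_cancel_right)
qed

lemma bounded_linear_projS: "bounded_linear (projS Ed)"
  by (intro linear_conv_bounded_linear[THEN iffD1] linearI) (simp_all add: projS_def vec_eq_iff)

lemma bounded_linear_transpose: "bounded_linear (transpose :: real^'n^'m \<Rightarrow> real^'m^'n)"
  by (intro linear_conv_bounded_linear[THEN iffD1] linearI) (simp_all add: transpose_def vec_eq_iff)

lemma has_real_derivative_inner_self:
  fixes A :: "real \<Rightarrow> 'a::real_inner"
  assumes "(A has_vector_derivative A') (at t within S)"
  shows "((\<lambda>t. inner (A t) (A t)) has_real_derivative 2 * inner (A t) A') (at t within S)"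
  using bounded_bilinear.has_vector_derivative[OF bounded_bilinear_inner assms assms]
  unfolding has_real_derivative_iff_has_vector_derivative by (simp add: inner_commute)

lemma stays_zero_if_locally_lipschitz:
  fixes A A' :: "real \<Rightarrow> 'a::real_inner"
  assumes deriv: "\<And>t. t \<ge> 0 \<Longrightarrow> (A has_vector_derivative A' t) (at t within {0..})"
    and lipschitz: "\<And>t. t \<ge> 0 \<Longrightarrow> A t = 0 \<Longrightarrow> \<exists>C. \<forall>\<^sub>F u in at_right t. norm (A' u) \<le> C * norm (A u)"
    and "A 0 = 0" and "t1 \<ge> 0"
  shows "A t1 = 0"
proof -
  have "inner (A t1) (A t1) = 0"
  proof (rule nonneg_stays_zero_if_locally_gronwall[where g = "\<lambda>t. inner (A t) (A t)"
        and g' = "\<lambda>t. 2 * inner (A t) (A' t)"])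
    fix t :: real assume "t \<ge> 0"
    then show "((\<lambda>t. inner (A t) (A t)) has_real_derivative 2 * inner (A t) (A' t)) (at t within {0..})"
      by (intro has_real_derivative_inner_self deriv)
  next
    fix t :: real assume "t \<ge> 0" "inner (A t) (A t) = 0"
    then obtain C where "\<forall>\<^sub>F u in at_right t. norm (A' u) \<le> C * norm (A u)"
      using lipschitz by auto
    then have "\<forall>\<^sub>F u in at_right t. 2 * inner (A u) (A' u) \<le> (2 * C) * inner (A u) (A u)"
    proof eventually_elim
      case (elim u)
      have "inner (A u) (A' u) \<le> norm (A u) * norm (A' u)"
        by (rule norm_cauchy_schwarz)
      also have "\<dots> \<le> C * inner (A u) (A u)"
        using mult_left_mono[OF elim norm_ge_zero[of "A u"]] by (simp add: dot_square_norm power2_eq_square mult_ac)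
      finally show ?case
        by simp
    qed
    then show "\<exists>C. \<forall>\<^sub>F u in at_right t. 2 * inner (A u) (A' u) \<le> C * inner (A u) (A u)" ..
  qed (use \<open>A 0 = 0\<close> \<open>t1 \<ge> 0\<close> in auto)
  then show ?thesis
    by simp
qed

lemma eventually_at_right_norm_le:
  fixes Y :: "real \<Rightarrow> 'a::real_normed_vector"
  assumes "continuous (at t0 within {0..}) Y" "t0 \<ge> 0"
  shows "\<forall>\<^sub>F t in at_right t0. norm (Y t) \<le> norm (Y t0) + 1"
  using eventually_at_right_near[OF assms zero_less_one]
proof eventually_elim
  case (elim t)
  then show ?case
    using norm_triangle_ineq2[of "Y t" "Y t0"] by linarith
qed

lemma tangent_proj_skew_le_near_symmetric:
  fixes Y0 :: "real^'n^'n"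
  assumes "transpose Y0 = Y0"
  obtains \<delta> C where "\<delta> > 0" "C \<ge> 0"
    "\<And>Y R. rank Y = rank Y0 \<Longrightarrow> norm (Y - Y0) < \<delta> \<Longrightarrow> transpose R = R \<Longrightarrow>
       norm (tangent_proj Y R - transpose (tangent_proj Y R)) \<le> C * norm R * norm (Y - transpose Y)"
proof -
  obtain \<delta> C where "\<delta> > 0" "C \<ge> 0"
    and preimages: "\<And>Z. rank Z = rank Y0 \<Longrightarrow> norm (Z - Y0) < \<delta> \<Longrightarrow> bounded_preimages Z C"
    using bounded_preimages_near_same_rank[of Y0] by blast
  show ?thesis
  proof
    show "\<delta> > 0" "4 * real CARD('n) * C \<ge> 0"
      using \<open>\<delta> > 0\<close> \<open>C \<ge> 0\<close> by auto
    fix Y R :: "real^'n^'n"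
    assume "rank Y = rank Y0" "norm (Y - Y0) < \<delta>" "transpose R = R"
    moreover have "norm (transpose Y - Y0) = norm (Y - Y0)"
      using norm_transpose_matrix[of "Y - Y0"] assms by (simp add: transpose_diff)
    ultimately have "bounded_preimages Y C" "bounded_preimages (transpose Y) C"
      using preimages by (auto simp: rank_transpose)
    then have "norm ((colproj Y - colproj (transpose Y)) *v x)
        \<le> 2 * C * norm (Y - transpose Y) * norm x" for x
      using \<open>C \<ge> 0\<close> by (rule colproj_transpose_diff_bound)
    then have "norm (tangent_proj Y R - transpose (tangent_proj Y R))
        \<le> 2 * real CARD('n) * (2 * C * norm (Y - transpose Y)) * norm R"
      by (rule norm_tangent_proj_skew_le[OF \<open>transpose R = R\<close>])
    then show "norm (tangent_proj Y R - transpose (tangent_proj Y R))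
        \<le> 4 * real CARD('n) * C * norm R * norm (Y - transpose Y)"
      by (simp add: mult_ac)
  qed
qed

lemma eventually_tangent_proj_skew_le:
  fixes Y R :: "real \<Rightarrow> real^'n^'n"
  assumes "continuous (at t0 within {0..}) Y" "t0 \<ge> 0" "transpose (Y t0) = Y t0"
    and rank: "\<And>t. t \<ge> 0 \<Longrightarrow> rank (Y t) = r"
    and R_sym: "\<And>t. t \<ge> 0 \<Longrightarrow> transpose (R t) = R t"
    and R_bound: "\<And>t. t \<ge> 0 \<Longrightarrow> norm (R t) \<le> b"
  shows "\<exists>C. \<forall>\<^sub>F t in at_right t0.
    norm (tangent_proj (Y t) (R t) - transpose (tangent_proj (Y t) (R t))) \<le> C * norm (Y t - transpose (Y t))"
proof -
  obtain \<delta> C where "\<delta> > 0" "C \<ge> 0" and skew_le: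
    "\<And>Y' R'. rank Y' = rank (Y t0) \<Longrightarrow> norm (Y' - Y t0) < \<delta> \<Longrightarrow> transpose R' = R' \<Longrightarrow>
       norm (tangent_proj Y' R' - transpose (tangent_proj Y' R')) \<le> C * norm R' * norm (Y' - transpose Y')"
    using tangent_proj_skew_le_near_symmetric[OF \<open>transpose (Y t0) = Y t0\<close>] by blast
  have "\<forall>\<^sub>F t in at_right t0. norm (Y t - Y t0) < \<delta>"
    using assms(1,2) \<open>\<delta> > 0\<close> by (rule eventually_at_right_near)
  with eventually_at_right_less
  have "\<forall>\<^sub>F t in at_right t0.
    norm (tangent_proj (Y t) (R t) - transpose (tangent_proj (Y t) (R t))) \<le> C * b * norm (Y t - transpose (Y t))"
  proof eventually_elim
    case (elim t)
    then have "t \<ge> 0"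
      using \<open>t0 \<ge> 0\<close> by simp
    then have "norm (tangent_proj (Y t) (R t) - transpose (tangent_proj (Y t) (R t)))
        \<le> C * norm (R t) * norm (Y t - transpose (Y t))"
      using elim rank[of t] rank[OF \<open>t0 \<ge> 0\<close>] R_sym[of t] by (intro skew_le) auto
    also have "\<dots> \<le> C * b * norm (Y t - transpose (Y t))"
      using R_bound[OF \<open>t \<ge> 0\<close>] \<open>C \<ge> 0\<close> by (intro mult_right_mono mult_left_mono) auto
    finally show ?case .
  qed
  then show ?thesis ..
qed

lemma tangent_flow_stays_symmetric:
  fixes Y R :: "real \<Rightarrow> real^'n^'n" and \<eta> :: "real \<Rightarrow> real"
  assumes deriv: "\<And>t. t \<ge> 0 \<Longrightarrow>
      (Y has_vector_derivative (- tangent_proj (Y t) (R t) + \<eta> t *\<^sub>R Y t)) (at t within {0..})"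
    and rank: "\<And>t. t \<ge> 0 \<Longrightarrow> rank (Y t) = r"
    and R_sym: "\<And>t. t \<ge> 0 \<Longrightarrow> transpose (R t) = R t"
    and R_bound: "\<And>t. t \<ge> 0 \<Longrightarrow> norm (R t) \<le> b"
    and \<eta>_bound: "\<And>t. t \<ge> 0 \<Longrightarrow> \<bar>\<eta> t\<bar> \<le> c * norm (Y t)"
    and "transpose (Y 0) = Y 0" and "t \<ge> 0"
  shows "transpose (Y t) = Y t"
proof -
  define T where "T t = tangent_proj (Y t) (R t)" for t
  define A where "A = (\<lambda>t. Y t - transpose (Y t))"
  define A' where "A' t = - (T t - transpose (T t)) + \<eta> t *\<^sub>R A t" for t
  have "(A has_vector_derivative A' t) (at t within {0..})" if "t \<ge> 0" for t
  proof -
    let ?D = "- T t + \<eta> t *\<^sub>R Y t"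
    have "(A has_vector_derivative ?D - transpose ?D) (at t within {0..})"
      unfolding A_def T_def
      by (intro has_vector_derivative_diff deriv[OF that]
          bounded_linear.has_vector_derivative[OF bounded_linear_transpose])
    moreover have "?D - transpose ?D = A' t"
      unfolding A'_def A_def by (simp add: transpose_def vec_eq_iff algebra_simps)
    ultimately show ?thesis
      by simp
  qed
  moreover have "\<exists>C. \<forall>\<^sub>F t in at_right t0. norm (A' t) \<le> C * norm (A t)" if "t0 \<ge> 0" "A t0 = 0" for t0
  proof -
    have cont: "continuous (at t0 within {0..}) Y"
      using deriv[OF \<open>t0 \<ge> 0\<close>] by (rule has_vector_derivative_continuous)
    have "transpose (Y t0) = Y t0"
      using \<open>A t0 = 0\<close> by (simp add: A_def)
    then have "\<exists>C. \<forall>\<^sub>F t in at_right t0. norm (T t - transpose (T t)) \<le> C * norm (A t)"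
      unfolding T_def A_def by (rule eventually_tangent_proj_skew_le[OF cont \<open>t0 \<ge> 0\<close> _ rank R_sym R_bound])
    then obtain C where "\<forall>\<^sub>F t in at_right t0. norm (T t - transpose (T t)) \<le> C * norm (A t)" ..
    moreover note eventually_at_right_norm_le[OF cont \<open>t0 \<ge> 0\<close>] eventually_at_right_less
    ultimately have "\<forall>\<^sub>F t in at_right t0. norm (A' t) \<le> (C + \<bar>c\<bar> * (norm (Y t0) + 1)) * norm (A t)"
    proof eventually_elim
      case (elim t)
      have "\<bar>\<eta> t\<bar> \<le> c * norm (Y t)"
        using \<eta>_bound elim(3) \<open>t0 \<ge> 0\<close> by simp
      also have "\<dots> \<le> \<bar>c\<bar> * (norm (Y t0) + 1)"
        using elim(2) by (intro mult_mono) auto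
      finally have "norm (\<eta> t *\<^sub>R A t) \<le> \<bar>c\<bar> * (norm (Y t0) + 1) * norm (A t)"
        by (simp add: mult_right_mono)
      then show ?case
        using elim(1) norm_triangle_ineq[of "- (T t - transpose (T t))" "\<eta> t *\<^sub>R A t"]
        by (simp add: A'_def algebra_simps norm_minus_commute)
    qed
    then show ?thesis ..
  qed
  moreover have "A 0 = 0"
    using \<open>transpose (Y 0) = Y 0\<close> by (simp add: A_def)
  ultimately have "A t = 0"
    using \<open>t \<ge> 0\<close> by (rule stays_zero_if_locally_lipschitz)
  then show ?thesis
    by (simp add: A_def)
qed

lemma abs_inner_projS_le:
  assumes "norm T \<le> c"
  shows "\<bar>inner T (projS Ed X)\<bar> \<le> c * norm X"
proof -
  have "\<bar>inner T (projS Ed X)\<bar> \<le> norm T * norm (projS Ed X)"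
    by (rule Cauchy_Schwarz_ineq2)
  also have "\<dots> \<le> c * norm X"
    using assms norm_projS_le[of Ed X] by (intro mult_mono) (auto intro: order_trans[OF norm_ge_zero])
  finally show ?thesis .
qed

lemma flow_keeps_projS_on_unit_sphere:
  fixes Y T :: "real \<Rightarrow> real^'n^'n"
  assumes deriv: "\<And>t. t \<ge> 0 \<Longrightarrow>
      (Y has_vector_derivative (- T t + inner (T t) (projS Ed (Y t)) *\<^sub>R Y t)) (at t within {0..})"
    and T_bound: "\<And>t. t \<ge> 0 \<Longrightarrow> norm (T t) \<le> b"
    and "norm (projS Ed (Y 0)) = 1" and "t \<ge> 0"
  shows "norm (projS Ed (Y t)) = 1"
proof -
  define E where "E = (\<lambda>t. projS Ed (Y t))"
  define \<eta> where "\<eta> t = inner (T t) (E t)" for t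
  define f where "f = (\<lambda>t. inner (E t) (E t) - 1)"
  have "(f has_vector_derivative 2 * \<eta> t * f t) (at t within {0..})" if "t \<ge> 0" for t
  proof -
    have "(E has_vector_derivative projS Ed (- T t + \<eta> t *\<^sub>R Y t)) (at t within {0..})"
      unfolding E_def \<eta>_def
      by (rule bounded_linear.has_vector_derivative[OF bounded_linear_projS deriv[OF that]])
    then have "((\<lambda>t. inner (E t) (E t)) has_real_derivative
        2 * inner (E t) (projS Ed (- T t + \<eta> t *\<^sub>R Y t))) (at t within {0..})"
      by (rule has_real_derivative_inner_self)
    moreover have "projS Ed (- T t + \<eta> t *\<^sub>R Y t) = \<eta> t *\<^sub>R E t - projS Ed (T t)"
      by (simp add: E_def projS_def vec_eq_iff)
    moreover have "inner (E t) (projS Ed (T t)) = \<eta> t"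
      unfolding E_def \<eta>_def by (metis inner_projS projS_idem inner_commute)
    ultimately have "((\<lambda>t. inner (E t) (E t)) has_real_derivative 2 * \<eta> t * f t) (at t within {0..})"
      by (simp add: f_def inner_diff_right right_diff_distrib mult.assoc)
    from DERIV_diff[OF this DERIV_const[of 1]] show ?thesis
      unfolding f_def by (simp add: has_real_derivative_iff_has_vector_derivative)
  qed
  moreover have "\<exists>C. \<forall>\<^sub>F t in at_right t0. norm (2 * \<eta> t * f t) \<le> C * norm (f t)" if "t0 \<ge> 0" for t0
  proof -
    have "continuous (at t0 within {0..}) Y"
      using deriv[OF \<open>t0 \<ge> 0\<close>] by (rule has_vector_derivative_continuous)
    from eventually_at_right_norm_le[OF this \<open>t0 \<ge> 0\<close>] eventually_at_right_less
    have "\<forall>\<^sub>F t in at_right t0. norm (2 * \<eta> t * f t) \<le> 2 * \<bar>b\<bar> * (norm (Y t0) + 1) * norm (f t)"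
    proof eventually_elim
      case (elim t)
      have "\<bar>\<eta> t\<bar> \<le> b * norm (Y t)"
        unfolding \<eta>_def E_def using T_bound elim(2) \<open>t0 \<ge> 0\<close> by (intro abs_inner_projS_le) simp
      also have "\<dots> \<le> \<bar>b\<bar> * (norm (Y t0) + 1)"
        using elim(1) by (intro mult_mono) auto
      finally show ?case
        by (simp add: abs_mult mult_right_mono)
    qed
    then show ?thesis ..
  qed
  moreover have "f 0 = 0"
    using \<open>norm (projS Ed (Y 0)) = 1\<close> by (simp add: f_def E_def dot_square_norm)
  ultimately have "f t = 0"
    using \<open>t \<ge> 0\<close> by (rule stays_zero_if_locally_lipschitz)
  then show ?thesis
    using norm_ge_zero[of "projS Ed (Y t)"] by (simp add: f_def E_def dot_square_norm power2_eq_1_iff)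
qed

lemma transpose_Rmat: "transpose (Rmat W k \<epsilon> E) = Rmat W k \<epsilon> E"
  unfolding Rmat_def Let_def transpose_def by (simp add: vec_eq_iff algebra_simps)

lemma poly_charpoly: "poly (charpoly A) lam = det (lam *\<^sub>R mat 1 - A)"
  for A :: "real^'n^'n"
proof -
  have entry: "poly ((if i = j then [:0, 1:] else 0) - [:A $ i $ j:]) lam
      = (if i = j then lam else 0) - A $ i $ j" for i j
    by simp
  have "poly (charpoly A) lam = (\<Sum>p | p permutes UNIV.
      of_int (sign p) * (\<Prod>i\<in>UNIV. (if i = p i then lam else 0) - A $ i $ p i))"
    unfolding charpoly_def det_def
    by (simp only: poly_sum poly_mult poly_of_int poly_prod vec_lambda_beta entry)
  also have "\<dots> = det (lam *\<^sub>R mat 1 - A)"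
    unfolding det_def by (simp add: mat_def if_distrib[of "(*) lam"] cong: if_cong)
  finally show ?thesis .
qed

lemma eigenvector_exists_of_charpoly_root:
  fixes A :: "real^'n^'n"
  assumes "poly (charpoly A) lam = 0"
  obtains x where "x \<noteq> 0" "A *v x = lam *\<^sub>R x"
proof -
  let ?B = "lam *\<^sub>R mat 1 - A"
  have "\<not> inj ((*v) ?B)"
    using assms by (simp add: poly_charpoly det_eq_0_rank less_rank_noninjective)
  then obtain u v where "u \<noteq> v" "?B *v u = ?B *v v"
    unfolding inj_def by blast
  then have "?B *v (u - v) = 0"
    by (simp add: matrix_vector_mult_diff_distrib)
  then have "A *v (u - v) = lam *\<^sub>R (u - v)"
    by (simp add: matrix_vector_mult_diff_rdistrib scaleR_matrix_vector_assoc[symmetric])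
  then show ?thesis
    using \<open>u \<noteq> v\<close> by (intro that[of "u - v"]) simp_all
qed

lemma norm_unit_eigvec:
  fixes A :: "real^'n^'n"
  assumes "poly (charpoly A) lam = 0"
  shows "norm (unit_eigvec A lam) = 1"
proof -
  obtain x where "x \<noteq> 0" "A *v x = lam *\<^sub>R x"
    using eigenvector_exists_of_charpoly_root[OF assms] .
  then have "norm ((1 / norm x) *\<^sub>R x) = 1 \<and> A *v ((1 / norm x) *\<^sub>R x) = lam *\<^sub>R ((1 / norm x) *\<^sub>R x)"
    by (simp add: matrix_vector_mult_scaleR)
  then show ?thesis
    unfolding unit_eigvec_def by (rule someI2) simp
qed

lemma charpoly_root_eig:
  fixes A :: "real^'n^'n"
  assumes "eig_simple A k"
  shows "poly (charpoly A) (eig A k) = 0"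
proof -
  have "length (eigenvalues A) = CARD('n)" "1 \<le> k" "k \<le> CARD('n)"
    using assms unfolding eig_simple_def by auto
  then have "eig A k \<in> set (eigenvalues A)" "eigenvalues A \<noteq> []"
    unfolding eig_def by auto
  then have "eig A k \<in> set_mset (proots (charpoly A))"
    unfolding eigenvalues_def by simp
  moreover have "charpoly A \<noteq> 0"
    using \<open>eigenvalues A \<noteq> []\<close> by (auto simp: eigenvalues_def)
  ultimately show ?thesis
    by simp
qed

lemma norm_Rmat_le:
  fixes W E :: "real^'n^'n"
  assumes "eig_simple (laplacian (W + \<epsilon> *\<^sub>R E)) k" "eig_simple (laplacian (W + \<epsilon> *\<^sub>R E)) (k + 1)"
  shows "norm (Rmat W k \<epsilon> E) \<le> 3 * real CARD('n) * real CARD('n)"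
proof -
  define M where "M = laplacian (W + \<epsilon> *\<^sub>R E)"
  define x where "x = unit_eigvec M (eig M (k + 1))"
  define y where "y = unit_eigvec M (eig M k)"
  have "norm x = 1" "norm y = 1"
    using assms by (simp_all add: x_def y_def M_def norm_unit_eigvec charpoly_root_eig)
  have products: "- 1 \<le> v $ i * v $ j" "v $ i * v $ j \<le> 1" if "norm v = 1" for v :: "real^'n" and i j
  proof -
    have "\<bar>v $ i * v $ j\<bar> \<le> 1"
      using that component_le_norm_cart[of v i] component_le_norm_cart[of v j]
      by (auto simp: abs_mult mult_le_one)
    then show "- 1 \<le> v $ i * v $ j" "v $ i * v $ j \<le> 1"
      by (simp_all add: abs_le_iff)
  qed
  have "\<bar>Rmat W k \<epsilon> E $ i $ j\<bar> \<le> 3" for i j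
  proof -
    have "Rmat W k \<epsilon> E $ i $ j
        = ((x $ i * x $ i - y $ i * y $ i) + (x $ j * x $ j - y $ j * y $ j)) / 2
          - x $ i * x $ j + y $ i * y $ j"
      unfolding Rmat_def Let_def x_def y_def M_def by simp
    then show ?thesis
      using products[OF \<open>norm x = 1\<close>, of i j] products[OF \<open>norm y = 1\<close>, of i j]
        products[OF \<open>norm x = 1\<close>, of i i] products[OF \<open>norm x = 1\<close>, of j j]
        products[OF \<open>norm y = 1\<close>, of i i] products[OF \<open>norm y = 1\<close>, of j j]
        zero_le_square[of "x $ i"] zero_le_square[of "x $ j"]
        zero_le_square[of "y $ i"] zero_le_square[of "y $ j"]
      unfolding abs_le_iff by (intro conjI; simp add: field_simps; linarith)
  qed
  then have "norm (Rmat W k \<epsilon> E) \<le> (\<Sum>i\<in>(UNIV::'n set). \<Sum>j\<in>(UNIV::'n set). 3)"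
    using norm_matrix_le_sum_abs_entries order_trans sum_mono by (metis (no_types, lifting))
  then show ?thesis
    by simp
qed

theorem proposition4p1:
  fixes Ed :: "('n::finite \<times> 'n) set"
    and W :: "real^'n^'n"
    and k :: nat and \<epsilon> :: real
    and Y :: "real \<Rightarrow> real^'n^'n"
    and Y0 :: "real^'n^'n"
  assumes Ed_sym: "\<And>i j. (i, j) \<in> Ed \<Longrightarrow> (j, i) \<in> Ed"
    and W_sym: "transpose W = W"
    and W_nonneg: "\<And>i j. W $ i $ j \<ge> 0"
    and W_supp: "\<And>i j. (i, j) \<notin> Ed \<Longrightarrow> W $ i $ j = 0"
    and k_range: "2 \<le> k" "k \<le> CARD('n) - 1"
    and eps_pos: "\<epsilon> > 0"
    and rank4: "\<And>t. t \<ge> 0 \<Longrightarrow> rank (Y t) = 4"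
    and ode: "\<And>t. t \<ge> 0 \<Longrightarrow>
       (Y has_vector_derivative
          (- tangent_proj (Y t) (Rmat W k \<epsilon> (projS Ed (Y t)))
           + (inner (tangent_proj (Y t) (Rmat W k \<epsilon> (projS Ed (Y t)))) (projS Ed (Y t)))
             *\<^sub>R Y t)) (at t within {0..})"
    and init: "Y 0 = Y0"
    and Y0_sym: "transpose Y0 = Y0"
    and Y0_rank: "rank Y0 = 4"
    and simple: "\<And>t. t \<ge> 0 \<Longrightarrow>
       eig_simple (laplacian (W + \<epsilon> *\<^sub>R projS Ed (Y t))) k \<and>
       eig_simple (laplacian (W + \<epsilon> *\<^sub>R projS Ed (Y t))) (k + 1)"
  shows "(\<forall>t\<ge>0. transpose (Y t) = Y t \<and> rank (Y t) = 4) \<and>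
         (norm (projS Ed Y0) = 1 \<longrightarrow> (\<forall>t\<ge>0. norm (projS Ed (Y t)) = 1))"
proof -
  define R where "R t = Rmat W k \<epsilon> (projS Ed (Y t))" for t
  define T where "T t = tangent_proj (Y t) (R t)" for t
  define c where "c = 6 * real CARD('n) ^ 3"
  have R_bound: "norm (R t) \<le> 3 * real CARD('n) * real CARD('n)" if "t \<ge> 0" for t
    using simple[OF that] unfolding R_def by (intro norm_Rmat_le) auto
  have T_bound: "norm (T t) \<le> c" if "t \<ge> 0" for t
  proof -
    have "norm (T t) \<le> 2 * real CARD('n) * norm (R t)"
      unfolding T_def by (rule norm_tangent_proj_le)
    also have "\<dots> \<le> 2 * real CARD('n) * (3 * real CARD('n) * real CARD('n))"
      using R_bound[OF that] by (intro mult_left_mono) auto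
    finally show ?thesis
      by (simp add: c_def power3_eq_cube)
  qed
  have \<eta>_bound: "\<bar>inner (T t) (projS Ed (Y t))\<bar> \<le> c * norm (Y t)" if "t \<ge> 0" for t
    using T_bound[OF that] by (rule abs_inner_projS_le)
  have "transpose (Y t) = Y t" if "t \<ge> 0" for t
    by (rule tangent_flow_stays_symmetric[OF ode[folded R_def] rank4 _ R_bound \<eta>_bound[unfolded T_def] _ that])
      (simp_all add: R_def transpose_Rmat init Y0_sym)
  moreover have "norm (projS Ed (Y t)) = 1" if "norm (projS Ed Y0) = 1" "t \<ge> 0" for t
    using flow_keeps_projS_on_unit_sphere[OF ode[folded R_def T_def] T_bound] that init by simp
  ultimately show ?thesis
    using rank4 by blast
qed

end
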